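(* For every string $S$ of length $n$, there exists a data structure of ${\rm O}(n^2)$ bits, in addition to $S$, that, given a query range $[l,r]$ with $0\le l\le r<n$, computes the mode index set of $[l,r]$ in ${\rm O}(|output|)$ time.
   Context: $S=S[0..n-1]$ is a string over an alphabet $\Sigma$. There is a bijection $\Sigma\to\{0,\dots,|\Sigma|-1\}$ computable in constant time. A mode of a non-empty multiset is an element whose multiplicity is at least that of every other element. The mode index set of $[l,r]$ is the set of positions $i\in[l,r]$ such that $S[i]$ is a mode of the multiset $\{S[l],\dots,S[r]\}$ and $S[j]\ne S[i]$ for all $j$ with $i<j\le r$. Equivalently, it contains the rightmost occurrence within $[l,r]$ of each mode. $|output|$ is the size of this set. Space is counted in bits and excludes $S$, which may be accessed during queries. *)

theory Defs
  imports Complex_Main "HOL-Library.Multiset"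
begin

definition is_mode :: "'a multiset \<Rightarrow> 'a \<Rightarrow> bool" where
  "is_mode M x \<longleftrightarrow> x \<in># M \<and> (\<forall>y. y \<in># M \<longrightarrow> count M y \<le> count M x)"

definition range_mset :: "'a list \<Rightarrow> nat \<Rightarrow> nat \<Rightarrow> 'a multiset" where
  "range_mset S l r = image_mset (\<lambda>i. S ! i) (mset_set {l..r})"

definition mode_index_set :: "'a list \<Rightarrow> nat \<Rightarrow> nat \<Rightarrow> nat set" where
  "mode_index_set S l r =
     {i \<in> {l..r}. is_mode (range_mset S l r) (S ! i) \<and> (\<forall>j. i < j \<and> j \<le> r \<longrightarrow> S ! j \<noteq> S ! i)}"

text \<open>
  Words of \<open>w\<close> bits are natural numbers below \<open>2 ^ w\<close>; every value written to a register is reduced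
  modulo \<open>2 ^ w\<close>. A program names finitely many registers, and these are its only working memory:
  the data structure (an array of words) and the string are read-only. Results are reported by
  appending them to an output list. Each instruction costs one time unit.
\<close>

datatype binop = Add | Sub | Mul | Div | Mod | BitAnd | BitOr | BitXor | ShiftL | ShiftR

datatype instr =
    Imm nat nat               \<comment> \<open>target register, constant\<close>
  | Arith binop nat nat nat   \<comment> \<open>target register, two source registers\<close>
  | LoadWord nat nat          \<comment> \<open>target register, register holding an index into the data structure\<close>
  | LoadSymbol nat nat        \<comment> \<open>target register, register holding a position of the string\<close>
  | Jump nat
  | JumpLess nat nat nat      \<comment> \<open>two registers to compare, jump target\<close>
  | JumpEq nat nat nat
  | Emit nat                  \<comment> \<open>register whose content is reported\<close>
  | Halt

text \<open>The truncation in subtraction never applies to arguments below \<open>2 ^ w\<close>: it wraps around.\<close>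

fun binop_val :: "nat \<Rightarrow> binop \<Rightarrow> nat \<Rightarrow> nat \<Rightarrow> nat" where
  "binop_val w Add x y = (x + y) mod 2 ^ w"
| "binop_val w Sub x y = (x + 2 ^ w - y) mod 2 ^ w"
| "binop_val w Mul x y = (x * y) mod 2 ^ w"
| "binop_val w Div x y = (x div y) mod 2 ^ w"
| "binop_val w Mod x y = (x mod y) mod 2 ^ w"
| "binop_val w BitAnd x y = (Bit_Operations.and x y) mod 2 ^ w"
| "binop_val w BitOr x y = (Bit_Operations.or x y) mod 2 ^ w"
| "binop_val w BitXor x y = (Bit_Operations.xor x y) mod 2 ^ w"
| "binop_val w ShiftL x y = (push_bit y x) mod 2 ^ w"
| "binop_val w ShiftR x y = (drop_bit y x) mod 2 ^ w"

datatype config = Config (pc: nat) (regs: "nat \<Rightarrow> nat") (outp: "nat list")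

definition set_reg :: "nat \<Rightarrow> nat \<Rightarrow> config \<Rightarrow> config" where
  "set_reg d v c = Config (Suc (pc c)) ((regs c)(d := v)) (outp c)"

definition jump_if :: "bool \<Rightarrow> nat \<Rightarrow> config \<Rightarrow> config" where
  "jump_if b t c = Config (if b then t else Suc (pc c)) (regs c) (outp c)"

text \<open>
  The arguments are the word length, the data structure \<open>D\<close> and the symbol codes \<open>X\<close> of the string.
  \<open>None\<close> means that no instruction can be executed: the machine has reached \<open>Halt\<close>, or it is
  stuck on a read outside \<open>D\<close> or \<open>X\<close>. A symbol code that does not fit in a word is delivered
  modulo \<open>2 ^ w\<close>, so no relation between alphabet size and word length is needed.
\<close>

fun exec_instr :: "nat \<Rightarrow> nat list \<Rightarrow> nat list \<Rightarrow> instr \<Rightarrow> config \<Rightarrow> config option" where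
  "exec_instr w D X (Imm d k) c = Some (set_reg d (k mod 2 ^ w) c)"
| "exec_instr w D X (Arith f d a b) c = Some (set_reg d (binop_val w f (regs c a) (regs c b)) c)"
| "exec_instr w D X (LoadWord d a) c =
     (if regs c a < length D then Some (set_reg d (D ! regs c a mod 2 ^ w) c) else None)"
| "exec_instr w D X (LoadSymbol d a) c =
     (if regs c a < length X then Some (set_reg d (X ! regs c a mod 2 ^ w) c) else None)"
| "exec_instr w D X (Jump t) c = Some (jump_if True t c)"
| "exec_instr w D X (JumpLess a b t) c = Some (jump_if (regs c a < regs c b) t c)"
| "exec_instr w D X (JumpEq a b t) c = Some (jump_if (regs c a = regs c b) t c)"
| "exec_instr w D X (Emit a) c = Some (Config (Suc (pc c)) (regs c) (outp c @ [regs c a]))"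
| "exec_instr w D X Halt c = None"

definition step :: "instr list \<Rightarrow> nat \<Rightarrow> nat list \<Rightarrow> nat list \<Rightarrow> config \<Rightarrow> config option" where
  "step P w D X c = (if pc c < length P then exec_instr w D X (P ! pc c) c else None)"

fun run :: "instr list \<Rightarrow> nat \<Rightarrow> nat list \<Rightarrow> nat list \<Rightarrow> nat \<Rightarrow> config \<Rightarrow> config option" where
  "run P w D X 0 c = Some c"
| "run P w D X (Suc t) c = Option.bind (step P w D X c) (run P w D X t)"

definition halted :: "instr list \<Rightarrow> config \<Rightarrow> bool" where
  "halted P c \<longleftrightarrow> pc c < length P \<and> P ! pc c = Halt"

definition query_start :: "nat \<Rightarrow> nat \<Rightarrow> config" where
  "query_start l r = Config 0 ((\<lambda>_. 0)(0 := l, 1 := r)) []"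

text \<open>Query \<open>[l, r]\<close> halts after exactly \<open>t\<close> instructions, having reported the list \<open>os\<close>.\<close>

definition query_result ::
  "instr list \<Rightarrow> nat \<Rightarrow> nat list \<Rightarrow> nat list \<Rightarrow> nat \<Rightarrow> nat \<Rightarrow> nat list \<Rightarrow> nat \<Rightarrow> bool" where
  "query_result P w D X l r os t \<longleftrightarrow>
     (\<exists>c. run P w D X t (query_start l r) = Some c \<and> halted P c \<and> outp c = os)"

text \<open>A data structure of at most \<open>B\<close> bits, held in words of \<open>w\<close> bits.\<close>

definition stored_in_bits :: "nat \<Rightarrow> nat list \<Rightarrow> nat \<Rightarrow> bool" where
  "stored_in_bits w D B \<longleftrightarrow> (\<forall>x \<in> set D. x < 2 ^ w) \<and> length D * w \<le> B"

text \<open>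
  Word length \<open>\<Theta>(log n)\<close> with explicit constants; \<open>n + 1\<close> avoids \<open>log 0\<close> and a zero
  word length at \<open>n = 1\<close>.
\<close>

definition word_length :: "nat \<Rightarrow> nat \<Rightarrow> nat \<Rightarrow> nat \<Rightarrow> bool" where
  "word_length a b n w \<longleftrightarrow>
     real a * log 2 (real n + 1) \<le> real w \<and> real w \<le> real b * log 2 (real n + 1)"

end

theory Submission
  imports Defs
begin

text \<open>
  Fix the left end \<open>l\<close> and let \<open>M r\<close> be the mode index set of \<open>[l, r]\<close>. Passing from \<open>r\<close> to
  \<open>r + 1\<close> leaves \<open>M\<close> unchanged, inserts \<open>r + 1\<close>, or replaces \<open>M\<close> by \<open>{r + 1}\<close>. So two bits per
  range suffice: whether \<open>r \<in> M r\<close> (\<open>r\<close> is marked) and whether \<open>M r = {r}\<close>. The set \<open>M r\<close>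
  consists of the marked positions going down from \<open>r\<close> to the first one with \<open>M p = {p}\<close>.

  To find the preceding marked position in constant time, every row is cut into blocks of
  \<open>k = \<lfloor>log\<^sub>2 (n + 1)\<rfloor>\<close> positions. A table shared by all rows gives, for each bit pattern of a
  block and each offset, the last set bit up to that offset; if there is none, a word stored with
  the block points to the last marked position before it, where the search succeeds at once.
  Words of \<open>O(log n)\<close> bits are used for blocks of about \<open>log n\<close> positions, so a row takes \<open>O(n)\<close> bits.
\<close>

section \<open>Modes after adding one element\<close>

lemma range_mset_Suc:
  assumes "l \<le> Suc r"
  shows "range_mset S l (Suc r) = add_mset (S ! Suc r) (range_mset S l r)"
proof -
  have "{l..Suc r} = insert (Suc r) {l..r}" using assms by auto
  then show ?thesis by (simp add: range_mset_def)
qed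

lemma is_mode_add_mset_other:
  assumes "is_mode (add_mset x M) y" "y \<noteq> x"
  shows "is_mode M y"
  unfolding is_mode_def
proof (intro conjI allI impI)
  show "y \<in># M" using assms by (auto simp: is_mode_def)
  fix z assume "z \<in># M"
  then have "count (add_mset x M) z \<le> count (add_mset x M) y"
    using assms(1) unfolding is_mode_def by simp
  with assms(2) show "count M z \<le> count M y" by (simp split: if_splits)
qed

text \<open>Some \<open>z\<close> strictly beats even the raised count of \<open>x\<close>, so the
  maximal multiplicity stays the same and \<open>x\<close> does not reach it, before or
  after.\<close>

lemma is_mode_add_mset_not_mode:
  assumes "\<not> is_mode (add_mset x M) x"
  shows "is_mode (add_mset x M) y \<longleftrightarrow> is_mode M y \<and> y \<noteq> x"
    and "\<not> is_mode M x"
proof -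
  obtain z where z: "z \<in># M" "z \<noteq> x" "count M z > Suc (count M x)"
    using assms unfolding is_mode_def by (auto simp: not_le split: if_splits)
  show "\<not> is_mode M x"
    using z unfolding is_mode_def by (auto dest: bspec)
  show "is_mode (add_mset x M) y \<longleftrightarrow> is_mode M y \<and> y \<noteq> x"
  proof
    assume "is_mode (add_mset x M) y"
    then show "is_mode M y \<and> y \<noteq> x"
      using assms is_mode_add_mset_other by metis
  next
    assume y: "is_mode M y \<and> y \<noteq> x"
    then have "count M z \<le> count M y" using z unfolding is_mode_def by blast
    with y z show "is_mode (add_mset x M) y" unfolding is_mode_def by auto
  qed
qed

text \<open>The raised count of \<open>x\<close> ties with the untouched count of \<open>y\<close>,
  so \<open>x\<close> was exactly one below the old maximum. The maximum stays, all old modes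
  survive and \<open>x\<close> joins them.\<close>

lemma is_mode_add_mset_tie:
  assumes x: "is_mode (add_mset x M) x" and y: "is_mode (add_mset x M) y" "y \<noteq> x"
  shows "is_mode (add_mset x M) z \<longleftrightarrow> z = x \<or> is_mode M z"
    and "\<not> is_mode M x"
proof -
  have cy: "count M y = Suc (count M x)" and ym: "y \<in># M"
    using x y unfolding is_mode_def by (auto simp: le_antisym)
  show nx: "\<not> is_mode M x"
    using cy ym unfolding is_mode_def by auto
  show "is_mode (add_mset x M) z \<longleftrightarrow> z = x \<or> is_mode M z"
  proof (cases "z = x")
    case False
    show ?thesis
    proof
      assume "is_mode (add_mset x M) z"
      then show "z = x \<or> is_mode M z"
        using is_mode_add_mset_other by metis
    next
      assume "z = x \<or> is_mode M z"
      then have z: "is_mode M z" using False by simp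
      then have "count M y \<le> count M z" using ym unfolding is_mode_def by blast
      with z cy False show "is_mode (add_mset x M) z" unfolding is_mode_def by auto
    qed
  qed (use x in simp)
qed

section \<open>Mode index sets as the right end moves\<close>

lemma mode_index_set_refl: "mode_index_set S l l = {l}"
  by (auto simp: mode_index_set_def is_mode_def range_mset_def)

lemma mode_index_set_subset: "mode_index_set S l r \<subseteq> {l..r}"
  by (auto simp: mode_index_set_def)

lemma last_in_mode_index_set_iff:
  "r \<in> mode_index_set S l r \<longleftrightarrow> l \<le> r \<and> is_mode (range_mset S l r) (S ! r)"
  by (auto simp: mode_index_set_def)

text \<open>The modes stay the same and \<open>S ! Suc r\<close> is none of them, so no rightmost
  occurrence of a mode moves.\<close>

lemma mode_index_set_unmarked:
  assumes "l \<le> r" "Suc r \<notin> mode_index_set S l (Suc r)"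
  shows "mode_index_set S l (Suc r) = mode_index_set S l r"
proof -
  let ?x = "S ! Suc r" and ?M = "range_mset S l r"
  have R: "range_mset S l (Suc r) = add_mset ?x ?M" using assms by (simp add: range_mset_Suc)
  have "\<not> is_mode (add_mset ?x ?M) ?x"
    using assms by (simp add: last_in_mode_index_set_iff R)
  note * = is_mode_add_mset_not_mode[OF this]
  show ?thesis
    unfolding mode_index_set_def R using *
    by (auto simp: le_Suc_eq)
qed

text \<open>Another member \<open>i\<close> is the last occurrence of its symbol, so this symbol
  differs from \<open>S ! Suc r\<close> and the two modes tie. As \<open>S ! Suc r\<close> was not a
  mode before, no earlier position has to be dropped.\<close>

lemma mode_index_set_tie:
  assumes "l \<le> r" "Suc r \<in> mode_index_set S l (Suc r)" "mode_index_set S l (Suc r) \<noteq> {Suc r}"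
  shows "mode_index_set S l (Suc r) = insert (Suc r) (mode_index_set S l r)"
proof -
  let ?x = "S ! Suc r" and ?M = "range_mset S l r"
  have R: "range_mset S l (Suc r) = add_mset ?x ?M" using assms by (simp add: range_mset_Suc)
  obtain i where i: "i \<in> mode_index_set S l (Suc r)" "i \<noteq> Suc r" using assms by auto
  then have "is_mode (add_mset ?x ?M) (S ! i)" "S ! i \<noteq> ?x"
    by (auto simp: mode_index_set_def R le_Suc_eq dest: spec[of _ "Suc r"])
  moreover have "is_mode (add_mset ?x ?M) ?x"
    using assms by (simp add: last_in_mode_index_set_iff R)
  ultimately have *: "is_mode (add_mset ?x ?M) z \<longleftrightarrow> z = ?x \<or> is_mode ?M z" "\<not> is_mode ?M ?x" for z
    using is_mode_add_mset_tie by metis+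
  show ?thesis
    unfolding mode_index_set_def R using * assms(1)
    by (auto simp: le_Suc_eq) (use le_imp_less_Suc in blast)
qed

lemma mode_index_set_skip:
  assumes "l \<le> p" "p \<le> r" "\<And>i. p < i \<Longrightarrow> i \<le> r \<Longrightarrow> i \<notin> mode_index_set S l i"
  shows "mode_index_set S l r = mode_index_set S l p"
  using assms(2,3)
proof (induction r rule: dec_induct)
  case (step m)
  then have "mode_index_set S l (Suc m) = mode_index_set S l m"
    using assms(1) by (intro mode_index_set_unmarked) auto
  with step show ?case by simp
qed simp

section \<open>Blocks as bit words and the search for the last mark\<close>

definition block_word :: "nat \<Rightarrow> (nat \<Rightarrow> bool) \<Rightarrow> nat \<Rightarrow> nat" where
  "block_word k Q q = horner_sum of_bool 2 (map (\<lambda>j. Q (q * k + j)) [0..<k])"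

lemma block_word_less: "block_word k Q q < 2 ^ k"
  unfolding block_word_def by (rule order_less_le_trans[OF horner_sum_of_bool_2_less]) simp

lemma bit_block_word: "bit (block_word k Q q) j \<longleftrightarrow> j < k \<and> Q (q * k + j)"
  by (auto simp: block_word_def bit_horner_sum_bit_iff)

text \<open>The shift by one keeps 0 free to signal that no bit is set.\<close>

definition last_bit :: "nat \<Rightarrow> nat \<Rightarrow> nat" where
  "last_bit v j = (if \<exists>i\<le>j. bit v i then Suc (GREATEST i. i \<le> j \<and> bit v i) else 0)"

lemma last_bit_eq_0_iff: "last_bit v j = 0 \<longleftrightarrow> (\<forall>i\<le>j. \<not> bit v i)"
  by (simp add: last_bit_def)

lemma last_bit_SucD:
  assumes "last_bit v j = Suc i"
  shows "i \<le> j" "bit v i" "\<And>i'. i < i' \<Longrightarrow> i' \<le> j \<Longrightarrow> \<not> bit v i'"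
proof -
  have ex: "\<exists>i\<le>j. bit v i"
    using assms by (metis last_bit_eq_0_iff nat.distinct(1))
  have i: "(GREATEST i. i \<le> j \<and> bit v i) = i"
    using assms unfolding last_bit_def if_P[OF ex] by (rule Suc_inject)
  have "i \<le> j \<and> bit v i"
    using GreatestI_ex_nat[of "\<lambda>i. i \<le> j \<and> bit v i" j] ex unfolding i by blast
  then show "i \<le> j" "bit v i" by auto
  show "\<not> bit v i'" if "i < i'" "i' \<le> j" for i'
    using Greatest_le_nat[of "\<lambda>i. i \<le> j \<and> bit v i" i' j] that unfolding i by auto
qed

lemma last_bit_le: "last_bit v j \<le> Suc j"
  using last_bit_SucD(1) by (cases "last_bit v j") auto

text \<open>The default 0 only has to fit in a word: whenever a query follows this pointer, the left
  end of its row is a mark before \<open>m\<close>.\<close>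

definition last_before :: "(nat \<Rightarrow> bool) \<Rightarrow> nat \<Rightarrow> nat" where
  "last_before Q m = (if \<exists>i<m. Q i then GREATEST i. i < m \<and> Q i else 0)"

lemma last_before_props:
  assumes "i < m" "Q i"
  shows "last_before Q m < m" "Q (last_before Q m)"
    "\<And>i'. last_before Q m < i' \<Longrightarrow> i' < m \<Longrightarrow> \<not> Q i'"
proof -
  have ex: "\<exists>i<m. Q i" using assms by blast
  then have e: "(GREATEST i. i < m \<and> Q i) = last_before Q m"
    by (simp only: last_before_def if_True)
  show "last_before Q m < m" "Q (last_before Q m)"
    using GreatestI_ex_nat[of "\<lambda>i. i < m \<and> Q i" m] ex unfolding e by (auto intro: less_imp_le)
  show "\<not> Q i'" if "last_before Q m < i'" "i' < m" for i'
    using Greatest_le_nat[of "\<lambda>i. i < m \<and> Q i" i' m] that unfolding e by auto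
qed

lemma last_before_le: "last_before Q m \<le> m"
proof (cases "\<exists>i<m. Q i")
  case True
  then show ?thesis using last_before_props(1) less_imp_le by blast
qed (simp only: last_before_def if_False le0)

text \<open>Used to bound the bits of the lookup table. The factor 2 absorbs \<open>k = 3\<close>,
  the only exponent with \<open>k * k > 2 ^ k\<close>.\<close>

lemma square_le_two_power: "k * k \<le> 2 * 2 ^ (k::nat)"
proof (induction k)
  case (Suc k)
  show ?case
  proof (cases "k < 3")
    case True
    then have "k = 0 \<or> k = 1 \<or> k = 2" by auto
    then show ?thesis by auto
  next
    case False
    then have "3 * k \<le> k * k" by (intro mult_le_mono1) simp
    then have "2 * k + 1 \<le> k * k" using False by linarith
    moreover have "Suc k * Suc k = k * k + (2 * k + 1)" by simp
    ultimately show ?thesis using Suc by simp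
  qed
qed simp

section \<open>Composition of runs\<close>

lemma run_add: "run P w D X (s + t) c = Option.bind (run P w D X s c) (run P w D X t)"
proof (induction s arbitrary: c)
  case (Suc s)
  show ?case by (cases "step P w D X c") (simp_all add: Suc)
qed simp

lemma run_trans:
  assumes "run P w D X s c = Some c'" "run P w D X t c' = r"
  shows "run P w D X (s + t) c = r"
  using assms by (simp add: run_add)

lemma run_numeral:
  "run P w D X (numeral v) c = Option.bind (step P w D X c) (run P w D X (pred_numeral v))"
  by (simp add: numeral_eq_Suc)

section \<open>Layout of the data structure\<close>

definition marked :: "'a list \<Rightarrow> nat \<Rightarrow> nat \<Rightarrow> bool" where
  "marked S l i \<longleftrightarrow> i \<in> mode_index_set S l i"

definition sole_mode :: "'a list \<Rightarrow> nat \<Rightarrow> nat \<Rightarrow> bool" where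
  "sole_mode S l i \<longleftrightarrow> mode_index_set S l i = {i}"

text \<open>The additional block takes the incomplete end of a row, so \<open>p div k\<close> is a
  valid block number for every \<open>p < n\<close>.\<close>

definition blocks_per_row :: "nat \<Rightarrow> nat \<Rightarrow> nat" where
  "blocks_per_row k n = Suc (n div k)"

definition row_base :: "nat \<Rightarrow> nat" where
  "row_base k = 3 + 2 ^ k * k"

definition row_entry :: "nat \<Rightarrow> 'a list \<Rightarrow> nat \<Rightarrow> nat \<Rightarrow> nat \<Rightarrow> nat" where
  "row_entry k S l q f =
     (if f = 0 then block_word k (marked S l) q
      else if f = 1 then block_word k (sole_mode S l) q
      else last_before (marked S l) (q * k))"

text \<open>
  The layout is: three parameters, the table of \<open>last_bit v j\<close> at \<open>3 + v * k + j\<close>, and from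
  \<open>row_base k\<close> on three words for each block \<open>q\<close> of each row \<open>l\<close>.
\<close>

definition entry :: "nat \<Rightarrow> 'a list \<Rightarrow> nat \<Rightarrow> nat" where
  "entry k S i =
     (if i = 0 then k
      else if i = 1 then blocks_per_row k (length S)
      else if i = 2 then row_base k
      else if i < row_base k then last_bit ((i - 3) div k) ((i - 3) mod k)
      else let m = (i - row_base k) div 3
           in row_entry k S (m div blocks_per_row k (length S))
                (m mod blocks_per_row k (length S)) ((i - row_base k) mod 3))"

definition mode_table :: "nat \<Rightarrow> 'a list \<Rightarrow> nat list" where
  "mode_table k S =
     map (entry k S) [0..<row_base k + 3 * (length S * blocks_per_row k (length S))]"

text \<open>
  Instruction 7 is the head of the search loop, with the current position in register 1.
  Registers 9 to 12 hold its block, its offset in the block, the address of the entries of the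
  block, and the outcome of the table lookup. Instruction 29 handles a failed lookup.
\<close>

definition query_program :: "instr list" where
  "query_program =
    [Imm 3 1,
     Imm 4 2,
     Imm 8 3,
     LoadWord 5 2,
     LoadWord 6 3,
     LoadWord 7 4,
     Arith Mul 6 6 0,
     Arith Div 9 1 5,
     Arith Mod 10 1 5,
     Arith Add 11 6 9,
     Arith Mul 11 11 8,
     Arith Add 11 11 7,
     LoadWord 12 11,
     Arith Mul 12 12 5,
     Arith Add 12 12 10,
     Arith Add 12 12 8,
     LoadWord 12 12,
     JumpEq 12 2 29,
     Arith Sub 12 12 3,
     Arith Mul 1 9 5,
     Arith Add 1 1 12,
     Emit 1,
     Arith Add 11 11 3,
     LoadWord 11 11,
     Arith ShiftR 11 11 12,
     Arith Mod 11 11 4,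
     JumpEq 11 3 32,
     Arith Sub 1 1 3,
     Jump 7,
     Arith Add 11 11 4,
     LoadWord 1 11,
     Jump 7,
     Halt]"

section \<open>Size and contents of the table\<close>

text \<open>\<open>k_le\<close> bounds the lookup table, and the fourth power in \<open>w_ge\<close>
  puts all addresses below \<open>2 ^ w\<close>, so that address arithmetic is never
  reduced.\<close>

locale mode_query =
  fixes S :: "'a list" and k w :: nat and X :: "nat list"
  assumes k_pos: "k \<ge> 1" and k_le: "2 ^ k \<le> Suc (length S)"
    and w_ge: "(Suc (length S)) ^ 4 \<le> 2 ^ w" and n_pos: "length S \<ge> 1"
begin

abbreviation "n \<equiv> length S"
abbreviation "B \<equiv> blocks_per_row k n"
abbreviation "D \<equiv> mode_table k S"
abbreviation "exec \<equiv> run query_program w D X"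

lemma mod_less_k: "p mod k < k"
  using k_pos by simp

lemma k_le_n: "k \<le> n"
  using order_less_le_trans[OF less_exp k_le] by (rule less_Suc_eq_le[THEN iffD1])

lemma B_le: "B \<le> Suc n"
  by (simp add: blocks_per_row_def)

lemma length_D: "length D = row_base k + 3 * (n * B)"
  by (simp add: mode_table_def)

lemma length_D_le: "length D \<le> 2 ^ w"
proof -
  define N where "N = Suc n"
  have "2 ^ k * k \<le> N * n" using mult_le_mono[OF k_le k_le_n] by (simp only: N_def)
  moreover have "n * B \<le> N * n" using mult_le_mono1[OF B_le, of n] by (simp only: N_def mult.commute)
  moreover have "N * N = N * n + N" by (simp only: N_def mult_Suc_right add.commute)
  moreover have "N \<ge> 2" using n_pos by (simp add: N_def)
  \<comment> \<open>The length is at most \<open>3 + 4 * (N * n)\<close>; the remaining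
    \<open>4 * N\<close> absorbs the 3. Since \<open>N\<close> is at least 2, the factor 4 is then
    at most \<open>N * N\<close>.\<close>
  ultimately have "length D \<le> 4 * (N * N)"
    unfolding length_D row_base_def by linarith
  also have "\<dots> \<le> (N * N) * (N * N)"
    using mult_le_mono[OF \<open>N \<ge> 2\<close> \<open>N \<ge> 2\<close>] by (intro mult_le_mono1) simp
  also have "\<dots> = N ^ 4" by (simp only: power4_eq_xxxx mult.assoc)
  also have "\<dots> \<le> 2 ^ w" using w_ge by (simp only: N_def)
  finally show ?thesis .
qed

text \<open>Together with \<open>length_D_le\<close> this puts every quantity up to
  \<open>n + 1\<close> below \<open>2 ^ w\<close>: positions, \<open>k\<close>, \<open>B\<close>,
  block words and table outcomes.\<close>

lemma length_D_ge: "2 * n + 2 \<le> length D"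
proof -
  have "n * 1 \<le> n * B" by (intro mult_le_mono) (simp_all add: blocks_per_row_def)
  then show ?thesis unfolding length_D row_base_def using n_pos by linarith
qed

lemma entry_less: "i < length D \<Longrightarrow> entry k S i < 2 ^ w"
proof -
  assume i: "i < length D"
  have B0: "B > 0" by (simp add: blocks_per_row_def)
  define m where "m = (i - row_base k) div 3"
  define q where "q = m mod B"
  have "q < B" using B0 by (simp add: q_def)
  then have "q * k \<le> n"
    by (simp add: blocks_per_row_def less_Suc_eq_le) (metis div_times_less_eq_dividend mult_le_mono1 order_trans)
  then have lb: "last_before Q (q * k) < 2 ^ w" for Q
    using last_before_le[of Q "q * k"] length_D_ge length_D_le by linarith
  have bw: "block_word k Q j < 2 ^ w" for Q j
    using block_word_less[of k Q j] k_le length_D_ge length_D_le by linarith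
  have j: "(i - 3) mod k < k" using k_pos by simp
  have "last_bit v ((i - 3) mod k) < 2 ^ w" for v
    using last_bit_le[of v "(i - 3) mod k"] j k_pos k_le_n
      length_D_ge length_D_le by linarith
  moreover have "n \<le> n * B" using B0 by simp
  then have "row_base k < 2 ^ w" "k < 2 ^ w" "B < 2 ^ w"
    using k_le_n B_le length_D_ge length_D_le length_D n_pos by linarith+
  ultimately show ?thesis
    using lb bw
    by (auto simp: entry_def Let_def row_entry_def m_def[symmetric] q_def[symmetric])
qed

lemma mode_table_bounded: "\<forall>x\<in>set D. x < 2 ^ w"
  using entry_less by (auto simp: mode_table_def)

lemma D_nth: "i < length D \<Longrightarrow> D ! i = entry k S i"
  by (simp add: mode_table_def)

lemma D_nth_mod: "i < length D \<Longrightarrow> D ! i mod 2 ^ w = entry k S i"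
  using entry_less by (simp add: D_nth)

lemma table_entry:
  assumes "v < 2 ^ k" "j < k"
  shows "v * k + j + 3 < row_base k" "entry k S (v * k + j + 3) = last_bit v j"
proof -
  have "v * k + j < Suc v * k" using assms by simp
  also have "\<dots> \<le> 2 ^ k * k" using assms by (intro mult_le_mono1) simp
  finally show *: "v * k + j + 3 < row_base k" by (simp add: row_base_def)
  then show "entry k S (v * k + j + 3) = last_bit v j"
    using assms by (simp add: entry_def)
qed

text \<open>Apart from the offset \<open>row_base k\<close>, the address is a mixed-radix numeral
  with digits \<open>l\<close>, \<open>q\<close>, \<open>f\<close> and radices \<open>B\<close> and
  3 for the last two, so \<open>div\<close> and \<open>mod\<close> recover the digits.\<close>

lemma entry_in_row:
  assumes "l < n" "q < B" "f < 3"
  shows "(l * B + q) * 3 + row_base k + f < length D"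
    "entry k S ((l * B + q) * 3 + row_base k + f) = row_entry k S l q f"
proof -
  have "l * B + q < Suc l * B" using assms by simp
  also have "\<dots> \<le> n * B" using assms by (intro mult_le_mono1) simp
  finally show "(l * B + q) * 3 + row_base k + f < length D" using assms by (simp add: length_D)
  have "(f + m * 3) div 3 = m" "(f + m * 3) mod 3 = f" for m
    using assms(3) by simp_all
  note this[of "l * B + q"]
  moreover have "row_base k \<ge> 3" by (simp add: row_base_def)
  ultimately show "entry k S ((l * B + q) * 3 + row_base k + f) = row_entry k S l q f"
    using assms by (simp add: entry_def Let_def add.commute add.left_commute)
qed

section \<open>Execution of the program\<close>

text \<open>The loop invariant: constants, parameters and the row offset, which the instructions
  from 7 on only read. Register 2 keeps its initial 0.\<close>

definition loop_regs :: "nat \<Rightarrow> (nat \<Rightarrow> nat) \<Rightarrow> bool" where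
  "loop_regs l R \<longleftrightarrow> R 2 = 0 \<and> R 3 = 1 \<and> R 4 = 2 \<and> R 5 = k \<and> R 6 = l * B \<and>
     R 7 = row_base k \<and> R 8 = 3"

lemma word_ge_4: "3 < (2::nat) ^ w"
  using length_D_le length_D_ge n_pos by linarith

lemma word_pos: "w > 0"
  using word_ge_4 by (cases w) simp_all

lemma mode_table_nonempty: "D \<noteq> []"
  using length_D_ge by auto

lemma prologue:
  assumes "l < n"
  shows "\<exists>R. exec 7 (query_start l r) = Some (Config 7 R []) \<and> loop_regs l R \<and> R 1 = r"
proof -
  have B0: "B \<ge> 1" by (simp add: blocks_per_row_def)
  \<comment> \<open>This product is the only arithmetic result of the prologue, so its bound is what
    rules out wrap-around.\<close>
  have "B * l \<le> n * B" using assms by (simp add: mult.commute)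
  also have "\<dots> < length D"
    unfolding length_D row_base_def by (rule le_less_trans[of _ "3 * (n * B)"]) simp_all
  finally have *: "B * l < 2 ^ w" using length_D_le by linarith
  have h: "2 < length D" unfolding length_D row_base_def by simp
  have "D ! 0 mod 2 ^ w = k" "D ! 1 mod 2 ^ w = B" "D ! 2 mod 2 ^ w = row_base k"
    using D_nth_mod[of 0] D_nth_mod[of 1] D_nth_mod[of 2] h
    by (simp_all add: entry_def del: length_greater_0_conv)
  then show ?thesis
    using * h word_ge_4
    by (simp add: word_pos mode_table_nonempty run_numeral step_def query_program_def
        query_start_def set_reg_def loop_regs_def mult.commute)
qed

text \<open>Instructions 7 to 16 are evaluated symbolically. Every intermediate value is part of a
  block number, an offset or a valid address in \<open>D\<close>, hence below
  \<open>2 ^ w\<close>.\<close>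

lemma lookup:
  assumes "l < n" "p < n" "loop_regs l R" "R 1 = p"
  shows "\<exists>R'. exec 10 (Config 7 R os) = Some (Config 17 R' os) \<and> loop_regs l R' \<and>
    R' 9 = p div k \<and> R' 11 = (l * B + p div k) * 3 + row_base k \<and>
    R' 12 = last_bit (block_word k (marked S l) (p div k)) (p mod k)"
proof -
  define q where "q = p div k"
  define j where "j = p mod k"
  define a where "a = (l * B + q) * 3 + row_base k"
  define v where "v = block_word k (marked S l) q"
  have q: "q < B" using assms by (simp add: q_def blocks_per_row_def div_le_mono less_Suc_eq_le)
  have j: "j < k" using k_pos by (simp add: j_def)
  have a: "a < length D" "D ! a mod 2 ^ w = v"
    using entry_in_row[OF assms(1) q, of 0] by (simp_all add: a_def D_nth_mod row_entry_def v_def)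
  have v: "v < 2 ^ k" unfolding v_def by (rule block_word_less)
  have t: "v * k + j + 3 < length D" "D ! (v * k + j + 3) mod 2 ^ w = last_bit v j"
    using table_entry[OF v j] by (simp_all add: D_nth_mod length_D)
  have q_le: "q \<le> p" by (simp add: q_def)
  have "q < 2 ^ w" "j < 2 ^ w" "a < 2 ^ w"
    using a(1) length_D_le length_D_ge q_le assms(2) j k_le_n by linarith+
  moreover have "m < 2 ^ w" "m * 3 < 2 ^ w" if "m * 3 + row_base k = a" for m
    using that \<open>a < 2 ^ w\<close> by linarith+
  note this[of "l * B + q"]
  moreover have "m < 2 ^ w" "m + j < 2 ^ w" "m + j + 3 < 2 ^ w" if "m + j + 3 < length D" for m
    using that length_D_le by linarith+
  note this[of "v * k"]
  ultimately have bounds: "q < 2 ^ w" "j < 2 ^ w" "a < 2 ^ w"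
    "l * B + q < 2 ^ w" "(l * B + q) * 3 < 2 ^ w" "v * k < 2 ^ w" "v * k + j < 2 ^ w" "v * k + j + 3 < 2 ^ w"
    using t(1) by (simp_all add: a_def)
  show ?thesis
    unfolding q_def[symmetric] j_def[symmetric] v_def[symmetric] a_def[symmetric]
    using assms(3,4) a t bounds
    by (simp add: run_numeral step_def query_program_def set_reg_def loop_regs_def
        q_def[symmetric] j_def[symmetric] a_def[symmetric] del: distrib_right_numeral)
qed

lemma no_mark_in_block:
  assumes "l < n" "p < n" "loop_regs l R" "R 1 = p"
    "last_bit (block_word k (marked S l) (p div k)) (p mod k) = 0"
  shows "\<exists>R'. exec 14 (Config 7 R os) = Some (Config 7 R' os) \<and> loop_regs l R' \<and>
    R' 1 = last_before (marked S l) (p div k * k)"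
proof -
  define q where "q = p div k"
  define a where "a = (l * B + q) * 3 + row_base k"
  have q: "q < B" using assms by (simp add: q_def blocks_per_row_def div_le_mono less_Suc_eq_le)
  obtain R' where R': "exec 10 (Config 7 R os) = Some (Config 17 R' os)" "loop_regs l R'"
    "R' 9 = q" "R' 11 = a" "R' 12 = 0"
    using lookup[OF assms(1-4)] assms(5) unfolding q_def a_def by metis
  have a: "a + 2 < length D" "D ! (a + 2) mod 2 ^ w = last_before (marked S l) (q * k)"
    using entry_in_row[OF assms(1) q, of 2] by (simp_all add: a_def D_nth_mod row_entry_def)
  then have "a + 2 < 2 ^ w" using length_D_le by linarith
  \<comment> \<open>Instructions 17, 29, 30 and 31: the jump on outcome 0 is taken and register 1
    receives the pointer.\<close>
  then have "\<exists>R''. exec 4 (Config 17 R' os) = Some (Config 7 R'' os) \<and> loop_regs l R'' \<and>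
    R'' 1 = last_before (marked S l) (q * k)"
    using R'(2-) a by (simp add: run_numeral step_def query_program_def set_reg_def jump_if_def loop_regs_def)
  then show ?thesis
    using run_trans[OF R'(1), of 4] by (simp add: q_def)
qed

text \<open>The ten instructions of the lookup are followed by 17 to 26 when the search ends, and by
  17 to 28 when it continues; this gives 20 and 22.\<close>

lemma mark_in_block:
  assumes "l < n" "p < n" "loop_regs l R" "R 1 = p"
    "last_bit (block_word k (marked S l) (p div k)) (p mod k) = Suc i"
  defines "p' \<equiv> p div k * k + i"
  shows "sole_mode S l p' \<Longrightarrow>
      \<exists>R'. exec 20 (Config 7 R os) = Some (Config 32 R' (os @ [p']))"
    and "\<not> sole_mode S l p' \<Longrightarrow> p' > 0 \<Longrightarrow>
      \<exists>R'. exec 22 (Config 7 R os) = Some (Config 7 R' (os @ [p'])) \<and> loop_regs l R' \<and> R' 1 = p' - 1"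
proof -
  define q where "q = p div k"
  define a where "a = (l * B + q) * 3 + row_base k"
  define u where "u = block_word k (sole_mode S l) q"
  have q: "q < B" using assms by (simp add: q_def blocks_per_row_def div_le_mono less_Suc_eq_le)
  obtain R' where R': "exec 10 (Config 7 R os) = Some (Config 17 R' os)" "loop_regs l R'"
    "R' 9 = q" "R' 11 = a" "R' 12 = Suc i"
    using lookup[OF assms(1-4)] assms(5) unfolding q_def a_def by metis
  have a: "Suc a < length D" "D ! Suc a mod 2 ^ w = u"
    using entry_in_row[OF assms(1) q, of 1] by (simp_all add: a_def D_nth_mod row_entry_def u_def)
  have i: "i \<le> p mod k" using last_bit_SucD(1)[OF assms(5)] .
  have ik: "i < k" using i mod_less_k by (rule le_less_trans)
  have p': "p' = q * k + i" by (simp add: p'_def q_def)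
  have "p' \<le> p" using i div_mult_mod_eq[of p k] unfolding p'_def by linarith
  then have bounds: "Suc i < 2 ^ w" "q * k < 2 ^ w" "q * k + i < 2 ^ w" "Suc a < 2 ^ w" "u < 2 ^ w"
    "i < 2 ^ w"
    using a length_D_le length_D_ge p' assms(2) ik k_le_n block_word_less[of k "sole_mode S l" q] k_le
    unfolding u_def by linarith+
  have drop: "drop_bit i u \<le> u" "drop_bit i u < 2 ^ w"
    using bounds by (auto simp: drop_bit_eq_div intro: le_less_trans[OF div_le_dividend])
  \<comment> \<open>The shift by \<open>i\<close> and the remainder modulo 2 extract bit
    \<open>i\<close> of the sole-mode word.\<close>
  have "odd (drop_bit i u) \<longleftrightarrow> sole_mode S l p'"
    using ik by (simp add: bit_iff_odd_drop_bit[symmetric] u_def bit_block_word p')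
  then have m: "drop_bit i u mod 2 = (if sole_mode S l p' then 1 else 0)"
    by (simp add: mod_2_eq_odd)
  show "\<exists>R'. exec 20 (Config 7 R os) = Some (Config 32 R' (os @ [p']))" if "sole_mode S l p'"
  proof -
    have "\<exists>R''. exec 10 (Config 17 R' os) = Some (Config 32 R'' (os @ [p']))"
      using R'(2-) a bounds drop m that word_ge_4
      by (simp add: word_pos run_numeral step_def query_program_def set_reg_def jump_if_def loop_regs_def p')
    then obtain R'' where "exec 10 (Config 17 R' os) = Some (Config 32 R'' (os @ [p']))"
      by blast
    with run_trans[OF R'(1) this(1)] show ?thesis by auto
  qed
  show "\<exists>R'. exec 22 (Config 7 R os) = Some (Config 7 R' (os @ [p'])) \<and> loop_regs l R' \<and> R' 1 = p' - 1"
    if "\<not> sole_mode S l p'" "p' > 0"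
  proof -
    \<comment> \<open>Machine subtraction wraps around at 0; \<open>p' > 0\<close> makes the
      decrement exact.\<close>
    have e: "(q * k + i + 2 ^ w - 1) mod 2 ^ w = q * k + i - 1"
    proof -
      have *: "q * k + i + 2 ^ w - 1 = (q * k + i - 1) + 2 ^ w"
        using that(2) unfolding p' by (intro diff_add_assoc2) linarith
      have "q * k + i - 1 < 2 ^ w" using bounds(3) by (rule le_less_trans[OF diff_le_self])
      then show ?thesis unfolding * mod_add_self2 by (rule mod_less)
    qed
    have "\<exists>R''. exec 12 (Config 17 R' os) = Some (Config 7 R'' (os @ [p'])) \<and> loop_regs l R'' \<and>
        R'' 1 = p' - 1"
      using R'(2-) a bounds drop m that(1) word_ge_4 e
      by (simp add: word_pos run_numeral step_def query_program_def set_reg_def jump_if_def loop_regs_def p')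
    then obtain R'' where "exec 12 (Config 17 R' os) = Some (Config 7 R'' (os @ [p']))" "loop_regs l R''" "R'' 1 = p' - 1"
      by blast
    with run_trans[OF R'(1) this(1)] show ?thesis by auto
  qed
qed


section \<open>From bits of a block to positions\<close>

lemma last_bit_eq_0_no_marks:
  assumes "last_bit (block_word k Q (p div k)) (p mod k) = 0" "p div k * k \<le> i" "i \<le> p"
  shows "\<not> Q i"
proof -
  define j where "j = i - p div k * k"
  have i: "i = p div k * k + j" using assms(2) by (simp add: j_def)
  then have "j \<le> p mod k" using assms(3) div_mult_mod_eq[of p k] by linarith
  moreover from this have "j < k" using mod_less_k[of p] by linarith
  ultimately show ?thesis
    using assms(1) by (auto simp: last_bit_eq_0_iff bit_block_word i)
qed

lemma last_bit_Suc_mark: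
  assumes "last_bit (block_word k Q (p div k)) (p mod k) = Suc i"
  shows "p div k * k + i \<le> p" "Q (p div k * k + i)"
    "\<And>i'. p div k * k + i < i' \<Longrightarrow> i' \<le> p \<Longrightarrow> \<not> Q i'"
proof -
  note * = last_bit_SucD[OF assms]
  show "p div k * k + i \<le> p" using *(1) div_mult_mod_eq[of p k] by linarith
  show "Q (p div k * k + i)" using *(2) by (simp add: bit_block_word)
  fix i' assume i': "p div k * k + i < i'" "i' \<le> p"
  define j where "j = i' - p div k * k"
  have j: "i' = p div k * k + j" using i' by (simp add: j_def)
  then have "j \<le> p mod k" "i < j" using i' div_mult_mod_eq[of p k] by linarith+
  moreover from this have "j < k" using mod_less_k[of p] by linarith
  ultimately show "\<not> Q i'"
    using *(3)[of j] by (simp add: bit_block_word j)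
qed

lemma marked_ge: "marked S l i \<Longrightarrow> l \<le> i"
  using mode_index_set_subset[of S l i] by (auto simp: marked_def)

text \<open>With \<open>sole_mode_refl\<close> this makes \<open>l\<close> a sentinel: every search
  in the row finds a mark, and the enumeration stops at \<open>l\<close> at the latest.\<close>

lemma marked_refl: "marked S l l"
  by (simp add: marked_def mode_index_set_refl)

lemma sole_mode_refl: "sole_mode S l l"
  by (simp add: sole_mode_def mode_index_set_refl)

section \<open>Enumeration of the mode index set\<close>

text \<open>A time bound \<open>T\<close> replaces an exact count because the stopping and
  continuing paths, with or without following a pointer, differ in length.\<close>

definition emits :: "nat \<Rightarrow> nat \<Rightarrow> nat \<Rightarrow> config \<Rightarrow> nat list \<Rightarrow> bool" where
  "emits l p T c os \<longleftrightarrow> (\<exists>t\<le>T. \<exists>R. if sole_mode S l p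
     then exec t c = Some (Config 32 R (os @ [p]))
     else exec t c = Some (Config 7 R (os @ [p])) \<and> loop_regs l R \<and> R 1 = p - 1)"

lemma emits_mono: "emits l p T c os \<Longrightarrow> T \<le> T' \<Longrightarrow> emits l p T' c os"
  unfolding emits_def by (elim exE conjE, rule exI, rule conjI, erule (1) order_trans, rule exI)

lemma emit_in_block:
  assumes "l < n" "p < n" "loop_regs l R" "R 1 = p"
    "last_bit (block_word k (marked S l) (p div k)) (p mod k) = Suc i"
  shows "emits l (p div k * k + i) 22 (Config 7 R os) os"
proof (cases "sole_mode S l (p div k * k + i)")
  case True
  obtain R' where "exec 20 (Config 7 R os) = Some (Config 32 R' (os @ [p div k * k + i]))"
    using mark_in_block(1)[OF assms True, of os] by blast
  then show ?thesis
    unfolding emits_def if_P[OF True] by (intro exI[of _ "20::nat"] conjI exI[of _ R']) simp_all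
next
  case False
  \<comment> \<open>By \<open>marked_ge\<close> a mark at 0 forces \<open>l = 0\<close>, but
    \<open>l\<close> is always a sole mode.\<close>
  have pos: "p div k * k + i > 0"
  proof (rule ccontr)
    assume "\<not> p div k * k + i > 0"
    then have "p div k * k + i = l" using marked_ge[OF last_bit_Suc_mark(2)[OF assms(5)]] by linarith
    then show False using False sole_mode_refl[of l] by metis
  qed
  obtain R' where "exec 22 (Config 7 R os) = Some (Config 7 R' (os @ [p div k * k + i])) \<and>
      loop_regs l R' \<and> R' 1 = p div k * k + i - 1"
    using mark_in_block(2)[OF assms False pos, of os] by (rule exE)
  then show ?thesis
    unfolding emits_def if_not_P[OF False]
    by (intro exI[of _ "22::nat"] conjI exI[of _ R']) simp_all
qed

text \<open>At most one lookup fails, since the pointer leads to a marked position. This costs 14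
  instructions before the final 22, in total 36.\<close>

lemma emit_next:
  assumes "l \<le> p" "p < n" "loop_regs l R" "R 1 = p"
  shows "\<exists>p'\<le>p. marked S l p' \<and> (\<forall>i. p' < i \<and> i \<le> p \<longrightarrow> \<not> marked S l i) \<and>
    emits l p' 36 (Config 7 R os) os"
proof (cases "last_bit (block_word k (marked S l) (p div k)) (p mod k)")
  case (Suc i)
  have "l < n" using assms by simp
  then have "emits l (p div k * k + i) 36 (Config 7 R os) os"
    by (intro emits_mono[OF emit_in_block[OF _ assms(2-4) Suc]]) simp_all
  then show ?thesis
    using last_bit_Suc_mark[OF Suc] by blast
next
  case 0
  have l: "l < n" using assms by simp
  define p1 where "p1 = last_before (marked S l) (p div k * k)"
  note gap = last_bit_eq_0_no_marks[OF 0]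
  \<comment> \<open>The marked position \<open>l\<close> is not among the searched positions of the
    block, so it lies before the block and the pointer is not the default.\<close>
  have "l < p div k * k" using gap[of l] marked_refl assms(1) by (meson not_le)
  note p1 = last_before_props[of l _ "marked S l", OF this marked_refl, folded p1_def]
  have "p div k * k \<le> p" by simp
  then have p1p: "p1 < p" "p1 < n" using p1(1) assms(2) by linarith+
  obtain R' where R': "exec 14 (Config 7 R os) = Some (Config 7 R' os)" "loop_regs l R'" "R' 1 = p1"
    using no_mark_in_block[OF l assms(2-4) 0] unfolding p1_def by metis
  have "last_bit (block_word k (marked S l) (p1 div k)) (p1 mod k) \<noteq> 0"
    using last_bit_eq_0_no_marks[of "marked S l" p1 p1] p1(2) by auto
  then obtain i where i: "last_bit (block_word k (marked S l) (p1 div k)) (p1 mod k) = Suc i"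
    using not0_implies_Suc by blast
  have "p1 div k * k + i = p1"
    using last_bit_Suc_mark[OF i] p1(2) by (meson le_refl le_neq_implies_less)
  then have "emits l p1 22 (Config 7 R' os) os"
    using emit_in_block[OF l p1p(2) R'(2,3) i, of os] by simp
  then obtain t R'' where t: "t \<le> 22" "if sole_mode S l p1
     then exec t (Config 7 R' os) = Some (Config 32 R'' (os @ [p1]))
     else exec t (Config 7 R' os) = Some (Config 7 R'' (os @ [p1])) \<and> loop_regs l R'' \<and> R'' 1 = p1 - 1"
    unfolding emits_def by blast
  then have "emits l p1 36 (Config 7 R os) os"
    unfolding emits_def using run_trans[OF R'(1), of t]
    by (intro exI[of _ "14 + t"] conjI exI[of _ R'']) auto
  moreover have "\<not> marked S l i" if "p1 < i" "i \<le> p" for i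
    using that gap[of i] p1(3)[of i] by (meson not_le)
  ultimately show ?thesis using p1p p1(2) less_imp_le by blast
qed

text \<open>Each round reports the last mark \<open>p'\<close> up to \<open>p\<close>. Either
  \<open>{p'}\<close> is the whole set, or the rest is the set of \<open>[l, p' - 1]\<close>, to
  which the induction applies. The at most 36 instructions of the round are charged to
  \<open>p'\<close>.\<close>

lemma enumerate:
  assumes "l \<le> p" "p < n" "loop_regs l R" "R 1 = p"
  shows "\<exists>t R' os'. exec t (Config 7 R os) = Some (Config 32 R' (os @ os')) \<and> distinct os' \<and>
    set os' = mode_index_set S l p \<and> t \<le> 36 * card (mode_index_set S l p)"
  using assms
proof (induction p arbitrary: R os rule: less_induct)
  case (less p)
  obtain p' where p': "p' \<le> p" "marked S l p'" "\<forall>i. p' < i \<and> i \<le> p \<longrightarrow> \<not> marked S l i"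
    "emits l p' 36 (Config 7 R os) os"
    using emit_next[OF less.prems] by blast
  have M: "mode_index_set S l p = mode_index_set S l p'"
    using p' marked_ge by (intro mode_index_set_skip) (auto simp: marked_def)
  obtain t R' where t: "t \<le> 36" "if sole_mode S l p'
     then exec t (Config 7 R os) = Some (Config 32 R' (os @ [p']))
     else exec t (Config 7 R os) = Some (Config 7 R' (os @ [p'])) \<and> loop_regs l R' \<and> R' 1 = p' - 1"
    using p'(4) unfolding emits_def by blast
  show ?case
  proof (cases "sole_mode S l p'")
    case True
    then show ?thesis
      using t M by (intro exI[of _ t] exI[of _ R'] exI[of _ "[p']"]) (simp add: sole_mode_def)
  next
    case False
    then have "l \<noteq> p'" using sole_mode_refl by auto
    then obtain r where r: "p' = Suc r" "l \<le> r"
      using marked_ge[OF p'(2)] by (cases p') auto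
    have M': "mode_index_set S l p = insert p' (mode_index_set S l r)"
      unfolding M r(1) using r p'(2) False
      by (intro mode_index_set_tie) (auto simp: marked_def sole_mode_def)
    have sub: "mode_index_set S l r \<subseteq> {l..r}" by (rule mode_index_set_subset)
    have "loop_regs l R'" "R' 1 = r" "exec t (Config 7 R os) = Some (Config 7 R' (os @ [p']))"
      using t False r by auto
    moreover have "r < p" "r < n" using r p'(1) less.prems by auto
    ultimately obtain t' R'' os' where t': "exec t' (Config 7 R' (os @ [p'])) = Some (Config 32 R'' ((os @ [p']) @ os'))"
      "distinct os'" "set os' = mode_index_set S l r" "t' \<le> 36 * card (mode_index_set S l r)"
      using less.IH[of r R' "os @ [p']"] r(2) by blast
    have "exec (t + t') (Config 7 R os) = Some (Config 32 R'' (os @ p' # os'))"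
      using run_trans[OF \<open>exec t _ = _\<close> t'(1)] by simp
    moreover have "p' \<notin> mode_index_set S l r" "finite (mode_index_set S l r)"
      using sub r finite_subset by auto
    ultimately show ?thesis
      using t(1) t' M' by (intro exI[of _ "t + t'"] exI[of _ R''] exI[of _ "p' # os'"]) auto
  qed
qed

lemma query_correct:
  assumes "l \<le> r" "r < n"
  shows "\<exists>os t. query_result query_program w D X l r os t \<and> distinct os \<and>
    set os = mode_index_set S l r \<and> t \<le> 43 * card (mode_index_set S l r)"
proof -
  have "l < n" using assms by simp
  then obtain R where R: "exec 7 (query_start l r) = Some (Config 7 R [])" "loop_regs l R" "R 1 = r"
    using prologue by blast
  obtain t R' os where t: "exec t (Config 7 R []) = Some (Config 32 R' ([] @ os))" "distinct os"
    "set os = mode_index_set S l r" "t \<le> 36 * card (mode_index_set S l r)"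
    using enumerate[OF assms R(2,3), of "[]"] by blast
  have "query_result query_program w D X l r os (7 + t)"
    using run_trans[OF R(1) t(1)] by (simp add: query_result_def halted_def query_program_def)
  \<comment> \<open>Some position is always reported, so the 7 instructions of the prologue can be
    charged to the output: 7 + 36 = 43.\<close>
  moreover have "mode_index_set S l r \<noteq> {}"
    using emit_next[OF assms R(2,3)] mode_index_set_skip[of l _ r S] marked_ge
    by (metis empty_iff marked_def)
  then have "card (mode_index_set S l r) \<ge> 1"
    using finite_subset[OF mode_index_set_subset[of S l r]] by (simp add: Suc_le_eq card_gt_0_iff)
  ultimately show ?thesis using t by (intro exI[of _ os] exI[of _ "7 + t"]) auto
qed

section \<open>Space bound and choice of constants\<close>

text \<open>Counted with \<open>k\<close> bits per word, the parameters, the lookup table and the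
  rows take at most 3, 8 and 6 times \<open>n * n\<close> bits; the true word length costs another
  factor \<open>2 * b\<close>.\<close>

lemma mode_table_size:
  assumes "w \<le> 2 * b * k"
  shows "length D * w \<le> 34 * b * n\<^sup>2"
proof -
  have n1: "n \<le> n * n" using n_pos by simp
  have "k * B \<le> n + k" by (simp add: blocks_per_row_def)
  then have "k * B \<le> 2 * n" using k_le_n by linarith
  then have nkB: "n * (k * B) \<le> n * (2 * n)" by (rule mult_le_mono2)
  have "2 ^ k \<le> 2 * n" using k_le n_pos by linarith
  moreover from this have "k * k \<le> 2 * (2 * n)" using square_le_two_power[of k] by linarith
  ultimately have "2 ^ k * (k * k) \<le> (2 * n) * (2 * (2 * n))" by (rule mult_le_mono)
  moreover have "length D * k = 3 * k + 2 ^ k * (k * k) + 3 * (n * (k * B))"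
    unfolding length_D row_base_def by (simp only: algebra_simps)
  ultimately have "length D * k \<le> 17 * (n * n)" using nkB k_le_n n1 by linarith
  have "length D * w \<le> length D * (2 * b * k)" using assms by (rule mult_le_mono2)
  also have "\<dots> = 2 * b * (length D * k)" by (simp only: mult.assoc mult.left_commute)
  also have "\<dots> \<le> 2 * b * (17 * (n * n))"
    using \<open>length D * k \<le> 17 * (n * n)\<close> by (rule mult_le_mono2)
  also have "\<dots> = 34 * b * n\<^sup>2" by (simp add: power2_eq_square)
  finally show ?thesis .
qed

end

text \<open>Take \<open>k\<close> as the floor of \<open>log 2 (n + 1)\<close>. The logarithm is
  below \<open>k + 1\<close>, hence at most \<open>2 * k\<close>, which bounds \<open>w\<close> from
  above; exponentiating the lower bound on \<open>w\<close> gives the fourth power.\<close>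

lemma word_length_bounds:
  assumes "word_length 4 b n w" "n \<ge> 1"
  obtains k where "k \<ge> 1" "2 ^ k \<le> Suc n" "Suc n ^ 4 \<le> 2 ^ w" "w \<le> 2 * b * k"
proof -
  obtain k where k: "2 ^ k \<le> Suc n" "Suc n < 2 ^ (k + 1)"
    using ex_power_ivl1[of 2 "Suc n"] by auto
  have k1: "k \<ge> 1" using k assms(2) by (cases k) auto
  let ?L = "log 2 (real n + 1)"
  have L: "2 powr ?L = real n + 1" by simp
  have "real (Suc n) < 2 ^ (k + 1)" using k(2) by (metis of_nat_less_iff of_nat_numeral of_nat_power)
  then have "2 powr ?L < 2 powr real (k + 1)" unfolding L by (subst powr_realpow) simp_all
  then have "?L < real (k + 1)" by (rule powr_less_cancel) simp
  then have "?L \<le> real (2 * k)" using k1 by linarith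
  then have "real b * ?L \<le> real b * real (2 * k)" by (rule mult_left_mono) simp
  then have "real w \<le> real (2 * b * k)"
    using assms(1) unfolding word_length_def by (simp add: mult.assoc mult.left_commute)
  then have "w \<le> 2 * b * k" by (simp only: of_nat_le_iff)
  moreover have "real (Suc n ^ 4) \<le> real (2 ^ w)"
  proof -
    have "real (Suc n ^ 4) = (2 powr ?L) ^ 4" unfolding L by (simp add: add.commute)
    also have "\<dots> = 2 powr (4 * ?L)" by (subst powr_power) (simp_all only: of_nat_numeral zero_neq_numeral[symmetric] not_False_eq_True)
    also have "\<dots> \<le> 2 powr real w"
      using assms(1) unfolding word_length_def by (intro powr_mono) auto
    finally show ?thesis by (simp add: powr_realpow)
  qed
  then have "Suc n ^ 4 \<le> 2 ^ w" by (simp only: of_nat_le_iff)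
  ultimately show thesis using that k1 k(1) by blast
qed

theorem theorem15:
  shows "\<exists>a\<ge>1. \<forall>b. \<exists>(P :: instr list) (C :: nat).
    \<forall>(\<Sigma> :: 'a set) (code :: 'a \<Rightarrow> nat) (S :: 'a list) (w :: nat).
      finite \<Sigma> \<and> bij_betw code \<Sigma> {..<card \<Sigma>} \<and> S \<in> lists \<Sigma> \<and> word_length a b (length S) w \<longrightarrow>
      (\<exists>D :: nat list.
         stored_in_bits w D (C * (length S)\<^sup>2) \<and>
         (\<forall>l r. l \<le> r \<and> r < length S \<longrightarrow>
            (\<exists>os t. query_result P w D (map code S) l r os t \<and>
                    distinct os \<and> set os = mode_index_set S l r \<and>
                    t \<le> C * card (mode_index_set S l r))))"
proof (intro exI[of _ "4::nat"] conjI allI)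
  fix b :: nat
  \<comment> \<open>The factor 4 provides the fourth power required by \<open>mode_query\<close>.
    One constant serves both bounds: \<open>34 * b\<close> for space plus 43 for time.\<close>
  have "\<exists>D. stored_in_bits w D ((34 * b + 43) * (length S)\<^sup>2) \<and>
      (\<forall>l r. l \<le> r \<and> r < length S \<longrightarrow>
        (\<exists>os t. query_result query_program w D (map code S) l r os t \<and>
          distinct os \<and> set os = mode_index_set S l r \<and>
          t \<le> (34 * b + 43) * card (mode_index_set S l r)))"
    if w: "word_length 4 b (length S) w" for code :: "'a \<Rightarrow> nat" and S :: "'a list" and w
  proof (cases "length S \<ge> 1")
    case False
    \<comment> \<open>The empty string admits no query, and an empty array meets the bound of 0
      bits.\<close>
    then show ?thesis by (intro exI[of _ "[]"]) (simp add: stored_in_bits_def)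
  next
    case True
    obtain k where k: "k \<ge> 1" "2 ^ k \<le> Suc (length S)" "Suc (length S) ^ 4 \<le> 2 ^ w" "w \<le> 2 * b * k"
      using word_length_bounds[OF w True] .
    interpret mode_query S k w "map code S"
      using k True by unfold_locales
    have "stored_in_bits w (mode_table k S) ((34 * b + 43) * (length S)\<^sup>2)"
      using mode_table_bounded mode_table_size[OF k(4)]
      by (auto simp: stored_in_bits_def intro: order_trans)
    moreover have "\<exists>os t. query_result query_program w (mode_table k S) (map code S) l r os t \<and>
        distinct os \<and> set os = mode_index_set S l r \<and>
        t \<le> (34 * b + 43) * card (mode_index_set S l r)"
      if "l \<le> r" "r < length S" for l r
    proof -
      have "43 * card (mode_index_set S l r) \<le> (34 * b + 43) * card (mode_index_set S l r)"
        by (rule mult_le_mono1) simp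
      then show ?thesis using query_correct[OF that] by (meson order_trans)
    qed
    ultimately show ?thesis by blast
  qed
  then show "\<exists>(P :: instr list) (C :: nat).
    \<forall>(\<Sigma> :: 'a set) (code :: 'a \<Rightarrow> nat) (S :: 'a list) (w :: nat).
      finite \<Sigma> \<and> bij_betw code \<Sigma> {..<card \<Sigma>} \<and> S \<in> lists \<Sigma> \<and> word_length 4 b (length S) w \<longrightarrow>
      (\<exists>D :: nat list.
         stored_in_bits w D (C * (length S)\<^sup>2) \<and>
         (\<forall>l r. l \<le> r \<and> r < length S \<longrightarrow>
            (\<exists>os t. query_result P w D (map code S) l r os t \<and>
                    distinct os \<and> set os = mode_index_set S l r \<and>
                    t \<le> C * card (mode_index_set S l r))))"
    by blast
qed simp

end
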